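(* Let $n\ge 2$. The simplex $\triangle_n=\operatorname{conv}(\mathcal{S}^{\boldsymbol{\tau}_n})\subset\mathbb{R}^n$, where $\boldsymbol{\tau}_n=23\cdots n1$, and the $(n-1)$-dimensional lecture-hall simplex $P_{n-1}\subset\mathbb{R}^{n-1}$ are integrally equivalent. In particular, for all integers $t\ge 0$, \[L_{\mathbb{Z}}(\triangle_n;t)=L_{\mathbb{Z}}(P_{n-1};t)=(t+1)^{n-1}.\]
   Context: Stack-sorting: for a finite sequence $\boldsymbol{\pi}=\pi_1\pi_2\cdots\pi_n$ of distinct elements of a totally ordered set, the output $s(\boldsymbol{\pi})$ is obtained as follows. Start with an empty stack (last-in, first-out) and an empty output. For $i=1,\dots,n$ in order: while the stack is nonempty and $\pi_i$ is greater than the top element of the stack, pop the top element and append it to the end of the output; then push $\pi_i$ onto the stack. After all entries have been pushed, pop all remaining elements from top to bottom, appending each to the output. Write $s^0(\boldsymbol{\pi})=\boldsymbol{\pi}$ and $s^{i}(\boldsymbol{\pi})=s(s^{i-1}(\boldsymbol{\pi}))$. For a permutation $\boldsymbol{\pi}$ of $\{1,\dots,n\}$, iterating $s$ eventually reaches the identity $12\cdots n$ (fixed by $s$), and $\mathcal{S}^{\boldsymbol{\pi}}:=\{s^0(\boldsymbol{\pi}),s^1(\boldsymbol{\pi}),s^2(\boldsymbol{\pi}),\dots\}$ is the finite set of all iterates until the identity is reached. Permutations $\pi_1\cdots\pi_n$ in one-line notation are identified with points $(\pi_1,\dots,\pi_n)\in\mathbb{R}^n$. The lecture-hall simplex of dimension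 $m$ is $P_m:=\operatorname{conv}\{\boldsymbol{\alpha}\in\mathbb{Z}^m: 0\le \alpha_1\le \frac{\alpha_2}{2}\le\cdots\le\frac{\alpha_m}{m}\le 1\}$. For a lattice polytope $P\subset\mathbb{R}^m$ and an integer $t\ge0$, $L_{\mathbb{Z}}(P;t):=|tP\cap\mathbb{Z}^m|$ with $tP=\{t\mathbf{x}:\mathbf{x}\in P\}$. Two lattice polytopes $P\subset\mathbb{R}^m$ and $Q\subset\mathbb{R}^k$ are integrally equivalent if there is an affine transformation $\varphi:\mathbb{R}^m\to\mathbb{R}^k$ whose restriction to $P$ preserves the lattice, i.e. $\varphi$ restricts to a bijection $P\cap\mathbb{Z}^m\leftrightarrow Q\cap\mathbb{Z}^k$. *)

theory Defs
  imports "HOL-Analysis.Analysis"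
begin

text \<open>The first argument is the current stack, top element first; the second is the remaining
  input. The result is the output produced from this configuration on.\<close>

fun stack_run :: "'a::linorder list \<Rightarrow> 'a list \<Rightarrow> 'a list" where
  "stack_run st [] = st"
| "stack_run [] (x # xs) = stack_run [x] xs"
| "stack_run (y # st) (x # xs) =
     (if x > y then y # stack_run st (x # xs) else stack_run (x # y # st) xs)"

definition stack_sort :: "'a::linorder list \<Rightarrow> 'a list" where
  "stack_sort xs = stack_run [] xs"

definition sort_iterates :: "'a::linorder list \<Rightarrow> 'a list set" where
  "sort_iterates xs = {(stack_sort ^^ i) xs | i. True}"

definition tau :: "nat \<Rightarrow> nat list" where
  "tau n = [2..<n + 1] @ [1]"

text \<open>Euclidean \<open>m\<close>-space is \<open>real ^ 'm\<close> with \<open>CARD('m) = m\<close>; a linear order on the index type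
  fixes which coordinate is the first, the second, and so on. The position of an index
  runs through \<open>1, \<dots>, m\<close>.\<close>

definition pos :: "'m::{finite,linorder} \<Rightarrow> nat" where
  "pos i = card {j. j \<le> i}"

text \<open>The point of a permutation in one-line notation; lists are indexed from 0.\<close>

definition perm_point :: "nat list \<Rightarrow> real ^ 'm::{finite,linorder}" where
  "perm_point xs = (\<chi> i. real (xs ! (pos i - 1)))"

definition int_points :: "(real ^ 'm) set" where
  "int_points = {x. \<forall>i. x $ i \<in> \<int>}"

definition lattice_polytope :: "(real ^ 'm) set \<Rightarrow> bool" where
  "lattice_polytope P \<longleftrightarrow> (\<exists>V. finite V \<and> V \<subseteq> int_points \<and> P = convex hull V)"

definition stack_sort_simplex :: "nat \<Rightarrow> (real ^ 'n::{finite,linorder}) set" where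
  "stack_sort_simplex n = convex hull (perm_point ` sort_iterates (tau n))"

definition lecture_hall_simplex :: "(real ^ 'm::{finite,linorder}) set" where
  "lecture_hall_simplex = convex hull
     {\<alpha> \<in> int_points. \<forall>i j. i \<le> j \<longrightarrow>
        0 \<le> \<alpha> $ i / real (pos i) \<and> \<alpha> $ i / real (pos i) \<le> \<alpha> $ j / real (pos j)
        \<and> \<alpha> $ j / real (pos j) \<le> 1}"

definition lattice_count :: "(real ^ 'm) set \<Rightarrow> nat \<Rightarrow> nat" where
  "lattice_count P t = card ((\<lambda>x. real t *\<^sub>R x) ` P \<inter> int_points)"

definition integrally_equivalent :: "(real ^ 'm) set \<Rightarrow> (real ^ 'k) set \<Rightarrow> bool" where
  "integrally_equivalent P Q \<longleftrightarrow> lattice_polytope P \<and> lattice_polytope Q \<and>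
     (\<exists>f c. linear f \<and> bij_betw (\<lambda>x. f x + c) (P \<inter> int_points) (Q \<inter> int_points))"

end

theory Submission
  imports Defs
begin

text \<open>
  Each application of the stack sort to \<open>2 3 \<dots> n 1\<close> moves the entry \<open>1\<close> one place to the left,
  past the largest entry that still precedes it (\<open>stack_sort_one_at\<close>). The orbit therefore consists
  of the \<open>n\<close> permutations in which \<open>1\<close> stands at place \<open>k\<close> and the other entries increase.

  Moving \<open>1\<close> from the first place to place \<open>k\<close> raises the sum of the first \<open>j\<close> entries by exactly \<open>j\<close>
  if \<open>j < k\<close> and leaves it unchanged if \<open>j \<ge> k\<close>. So the affine map that sends \<open>x\<close> to the vector with
  coordinates \<open>j + (1 + \<dots> + j) - (x\<^sub>1 + \<dots> + x\<^sub>j)\<close>, \<open>1 \<le> j < n\<close>, takes this permutation to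
  \<open>(0, \<dots>, 0, k, k + 1, \<dots>, n - 1)\<close>. These are the vertices of the lecture-hall simplex: written in
  the ratios \<open>\<alpha>\<^sub>j / j\<close>, the inequalities say that the ratios increase from \<open>0\<close> to \<open>1\<close>, and the
  barycentric coordinates of \<open>\<alpha>\<close> are the increments of the ratios (\<open>lecture_hall_simplex_eq\<close>).
  All points of the stack-sort simplex have coordinate sum \<open>1 + \<dots> + n\<close>, so a point is recovered from
  its first \<open>n - 1\<close> prefix sums, and it is integral exactly when they are. Hence the map is a
  bijection between lattice points, and after scaling the translation part this persists for all
  dilates (\<open>bij_betw_dilated_simplices\<close>).

  The lattice points of the \<open>t\<close>-th dilate of the lecture-hall simplex are the integer sequences with
  \<open>0 \<le> a\<^sub>1 / 1 \<le> \<dots> \<le> a\<^sub>m / m \<le> t\<close>. The count is obtained by fixing the last entry, which requires a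
  bound \<open>a\<^sub>m \<le> N\<close> for arbitrary \<open>N\<close> and not only for multiples of \<open>m\<close>. For \<open>N = m t + r\<close> with
  \<open>0 \<le> r \<le> m\<close> the number is \<open>(t + 1)\<^bsup>m - r\<^esup> (t + 2)\<^bsup>r\<^esup>\<close> (\<open>card_lecture_hall_seqs\<close>).
\<close>

section \<open>The orbit of \<open>2 3 \<dots> n 1\<close>\<close>

definition one_at :: "nat \<Rightarrow> nat \<Rightarrow> nat list" where
  "one_at n k = [2..<k + 1] @ 1 # [k + 1..<n + 1]"

text \<open>As long as the input increases, each new entry expels the single entry on the stack.\<close>

lemma stack_run_increasing:
  assumes "sorted_wrt (<) (y # xs)"
  shows "stack_run [y] (xs @ zs) = butlast (y # xs) @ stack_run [last (y # xs)] zs"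
  using assms by (induction xs arbitrary: y) auto

text \<open>When \<open>1\<close> is read, the stack holds only \<open>k + 1\<close>, the entry just before it. The entry \<open>1\<close> is
  pushed on top and leaves before \<open>k + 1\<close> does, so the two change places; everything else passes
  through in order.\<close>

lemma stack_sort_one_at:
  assumes "1 \<le> k" "k < n"
  shows "stack_sort (one_at n (Suc k)) = one_at n k"
proof -
  have u: "2 # [3..<k + 2] = [2..<k + 2]"
    using assms by (simp add: upt_conv_Cons numeral_3_eq_3)
  have u': "[2..<k + 2] = [2..<k + 1] @ [k + 1]"
    using assms by (simp add: upt_Suc_append)
  have a: "stack_sort (one_at n (Suc k)) = stack_run [2] ([3..<k + 2] @ 1 # [k + 2..<n + 1])"
    unfolding stack_sort_def one_at_def using u[symmetric] by (simp del: upt_Suc)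
  have "sorted_wrt (<) (2 # [3..<k + 2])"
    unfolding u by (rule sorted_wrt_upt)
  from stack_run_increasing[OF this, of "1 # [k + 2..<n + 1]"] 
  have b: "stack_sort (one_at n (Suc k)) = [2..<k + 1] @ stack_run [k + 1] (1 # [k + 2..<n + 1])"
    unfolding a u u' by simp
  have c: "stack_run [k + 1] (1 # [k + 2..<n + 1]) = 1 # [k + 1..<n + 1]"
  proof (cases "k + 2 < n + 1")
    case True
    have u2: "[k + 2..<n + 1] = (k + 2) # [k + 3..<n + 1]"
      using True by (simp add: upt_conv_Cons numeral_3_eq_3)
    have u3: "(k + 1) # [k + 2..<n + 1] = [k + 1..<n + 1]"
      using True by (simp add: upt_conv_Cons)
    have "sorted_wrt (<) ((k + 1) # [k + 2..<n + 1])"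
      unfolding u3 by (rule sorted_wrt_upt)
    from stack_run_increasing[OF this, of "[]"]
    have "stack_run [k + 1] [k + 2..<n + 1] = (k + 1) # [k + 2..<n + 1]"
      by (simp only: append_Nil2 stack_run.simps append_butlast_last_id list.distinct simp_thms)
    moreover have "stack_run [k + 1] (1 # [k + 2..<n + 1]) = 1 # stack_run [k + 1] [k + 2..<n + 1]"
      unfolding u2 using assms by simp
    ultimately show ?thesis unfolding u3 by simp
  next
    case False
    then have "n = k + 1" using assms by simp
    then show ?thesis using assms by simp
  qed
  show ?thesis using b unfolding c one_at_def[of n k] .
qed

lemma stack_sort_identity:
  shows "stack_sort (one_at n 1) = one_at n 1"
proof -
  have u: "1 # [2..<n + 1] = (if n = 0 then [1] else [1..<n + 1])"
    by (simp add: upt_conv_Cons numeral_2_eq_2)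
  have "sorted_wrt (<) (1 # [2..<n + 1])"
    unfolding u using sorted_wrt_upt[of 1 "n + 1"] by (simp del: upt_Suc)
  from stack_run_increasing[OF this, of "[]"]
  have "stack_run [1] [2..<n + 1] = 1 # [2..<n + 1]"
    by (simp only: append_Nil2 stack_run.simps append_butlast_last_id list.distinct simp_thms)
  then show ?thesis by (simp add: stack_sort_def one_at_def numeral_2_eq_2)
qed

lemma stack_sort_iterate_tau:
  assumes "1 \<le> n"
  shows "(stack_sort ^^ i) (tau n) = one_at n (max 1 (n - i))"
proof (induction i)
  case 0
  then show ?case using assms by (simp add: tau_def one_at_def max_def)
next
  case (Suc i)
  show ?case
  proof (cases "Suc i < n")
    case True
    then have "max 1 (n - i) = Suc (n - Suc i)" "max 1 (n - Suc i) = n - Suc i" by auto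
    then show ?thesis
      using Suc stack_sort_one_at[of "n - Suc i" n] True by simp
  next
    case False
    then have "max 1 (n - i) = 1" "max 1 (n - Suc i) = 1" by auto
    then show ?thesis using Suc stack_sort_identity[of n] by simp
  qed
qed

lemma sort_iterates_tau:
  assumes "1 \<le> n"
  shows "sort_iterates (tau n) = one_at n ` {1..n}"
proof
  show "sort_iterates (tau n) \<subseteq> one_at n ` {1..n}"
    using assms by (auto simp: sort_iterates_def stack_sort_iterate_tau)
  show "one_at n ` {1..n} \<subseteq> sort_iterates (tau n)"
  proof
    fix xs assume "xs \<in> one_at n ` {1..n}"
    then obtain k where "k \<in> {1..n}" "xs = one_at n k" by auto
    then have "xs = (stack_sort ^^ (n - k)) (tau n)"
      using assms by (simp add: stack_sort_iterate_tau max_def)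
    then show "xs \<in> sort_iterates (tau n)" by (auto simp: sort_iterates_def)
  qed
qed

lemma nth_one_at:
  assumes "1 \<le> k" "k \<le> n" "j < n"
  shows "one_at n k ! j = (if Suc j < k then j + 2 else if Suc j = k then 1 else Suc j)"
  using assms by (auto simp: one_at_def nth_append nth_Cons' simp del: upt_Suc)

text \<open>Compared with the identity permutation, the entries before the place of \<open>1\<close> are larger by one;
  the entry \<open>1\<close> itself makes up for the accumulated excess.\<close>

lemma sum_one_at:
  assumes "1 \<le> k" "k \<le> n" "j \<le> n"
  shows "(\<Sum>p<j. one_at n k ! p) = (if j < k then j else 0) + \<Sum>{..j}"
  using assms(3)
proof (induction j)
  case 0
  then show ?case by simp
next
  case (Suc j)
  then show ?case using nth_one_at[OF assms(1,2), of j] by auto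
qed

section \<open>Positions and prefix sums\<close>

lemma strict_mono_pos: "strict_mono (pos :: 'm::{finite,linorder} \<Rightarrow> nat)"
proof (rule strict_monoI)
  fix i j :: 'm assume "i < j"
  then have "{k. k \<le> i} \<subseteq> {k. k \<le> j}" "j \<in> {k. k \<le> j} - {k. k \<le> i}" by auto
  then have "{k. k \<le> i} \<subset> {k. k \<le> j}" by blast
  then show "pos i < pos j" unfolding pos_def by (intro psubset_card_mono) auto
qed

lemma bij_betw_pos: "bij_betw (pos :: 'm::{finite,linorder} \<Rightarrow> nat) UNIV {1..CARD('m)}"
proof -
  have inj: "inj (pos :: 'm \<Rightarrow> nat)" by (rule strict_mono_imp_inj_on[OF strict_mono_pos])
  have "range (pos :: 'm \<Rightarrow> nat) \<subseteq> {1..CARD('m)}"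
  proof safe
    fix i :: 'm
    have "0 < card {j. j \<le> i}" by (auto simp: card_gt_0_iff)
    moreover have "card {j. j \<le> i} \<le> CARD('m)" by (rule card_mono) auto
    ultimately show "pos i \<in> {1..CARD('m)}" by (simp add: pos_def)
  qed
  moreover have "card (range (pos :: 'm \<Rightarrow> nat)) = CARD('m)"
    using inj by (rule card_image)
  ultimately have "range (pos :: 'm \<Rightarrow> nat) = {1..CARD('m)}"
    by (intro card_subset_eq) auto
  with inj show ?thesis by (simp add: bij_betw_def)
qed

lemma pos_ge_1: "1 \<le> pos (i :: 'm::{finite,linorder})"
  and pos_le_card: "pos i \<le> CARD('m)"
  using bij_betwE[OF bij_betw_pos] by auto

lemma pos_inject: "pos i = pos j \<longleftrightarrow> i = (j :: 'm::{finite,linorder})"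
  using bij_betw_pos[where 'm='m] by (auto simp: bij_betw_def inj_eq)

lemma pos_le_iff: "pos i \<le> pos j \<longleftrightarrow> i \<le> (j :: 'm::{finite,linorder})"
  by (rule strict_mono_less_eq[OF strict_mono_pos])

lemma ex_pos:
  assumes "1 \<le> k" "k \<le> CARD('m)"
  obtains i :: "'m::{finite,linorder}" where "pos i = k"
  using bij_betw_imp_surj_on[OF bij_betw_pos[where 'm='m]] assms by (metis atLeastAtMost_iff imageE)

definition prefix_sum :: "real ^ 'n::{finite,linorder} \<Rightarrow> nat \<Rightarrow> real" where
  "prefix_sum x k = (\<Sum>i | pos i \<le> k. x $ i)"

lemma prefix_sum_add: "prefix_sum (x + y) k = prefix_sum x k + prefix_sum y k"
  and prefix_sum_scaleR: "prefix_sum (a *\<^sub>R x) k = a * prefix_sum x k"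
  by (simp_all add: prefix_sum_def sum.distrib sum_distrib_left)

text \<open>Coordinates are differences of consecutive prefix sums, so prefix sums determine a vector and
  decide whether it is integral.\<close>

lemma nth_eq_prefix_sum_diff: "x $ i = prefix_sum x (pos i) - prefix_sum x (pos i - 1)"
proof -
  have "{j. pos j \<le> pos i} = insert i {j. pos j \<le> pos i - 1}"
    using pos_ge_1[of i] by (auto simp: pos_inject[symmetric])
  moreover have "i \<notin> {j. pos j \<le> pos i - 1}"
    using pos_ge_1[of i] by auto
  ultimately show ?thesis by (simp add: prefix_sum_def)
qed

lemma prefix_sum_perm_point:
  assumes "k \<le> CARD('n)"
  shows "prefix_sum (perm_point xs :: real ^ 'n::{finite,linorder}) k = real (\<Sum>p<k. xs ! p)"
proof -
  have img: "(\<lambda>i::'n. pos i - 1) ` {i. pos i \<le> k} = {..<k}"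
  proof safe
    fix i :: 'n assume "pos i \<le> k"
    then show "pos i - 1 < k" using pos_ge_1[of i] by linarith
  next
    fix p assume "p < k"
    then obtain i :: 'n where "pos i = Suc p"
      using ex_pos[where 'm='n, of "Suc p"] assms by auto
    then show "p \<in> (\<lambda>i::'n. pos i - 1) ` {i. pos i \<le> k}"
      using \<open>p < k\<close> by (intro image_eqI[of _ _ i]) auto
  qed
  have "inj_on (\<lambda>i::'n. pos i - 1) {i. pos i \<le> k}"
  proof (rule inj_onI)
    fix i j :: 'n assume "pos i - 1 = pos j - 1"
    then have "pos i = pos j" using pos_ge_1[of i] pos_ge_1[of j] by linarith
    then show "i = j" by (simp add: pos_inject)
  qed
  from sum.reindex[OF this, of "\<lambda>p. real (xs ! p)"] show ?thesis
    unfolding img by (simp add: prefix_sum_def perm_point_def)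
qed

section \<open>The lecture-hall simplex by inequalities and by vertices\<close>

text \<open>The defining inequalities, over the reals and with the upper bound \<open>1\<close> replaced by \<open>t\<close>.\<close>

definition lecture_hall_region :: "real \<Rightarrow> (real ^ 'm::{finite,linorder}) set" where
  "lecture_hall_region t = {\<alpha>. \<forall>i j. i \<le> j \<longrightarrow>
     0 \<le> \<alpha> $ i / real (pos i) \<and> \<alpha> $ i / real (pos i) \<le> \<alpha> $ j / real (pos j)
     \<and> \<alpha> $ j / real (pos j) \<le> t}"

text \<open>For \<open>k = 1, \<dots>, m + 1\<close> these are the points at which the ratios \<open>\<alpha>\<^sub>j / j\<close> jump from \<open>0\<close> to \<open>1\<close>
  at position \<open>k\<close>; the last one is the origin.\<close>

definition lecture_hall_vertex :: "nat \<Rightarrow> real ^ 'm::{finite,linorder}" where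
  "lecture_hall_vertex k = (\<chi> j. if k \<le> pos j then real (pos j) else 0)"

lemma convex_lecture_hall_region: "convex (lecture_hall_region t :: (real ^ 'm::{finite,linorder}) set)"
proof (rule convexI)
  fix x y :: "(real, 'm) vec" and u v :: real
  assume x: "x \<in> lecture_hall_region t" and y: "y \<in> lecture_hall_region t"
    and uv: "0 \<le> u" "0 \<le> v" "u + v = 1"
  have eq: "(u *\<^sub>R x + v *\<^sub>R y) $ i / real (pos i)
      = u * (x $ i / real (pos i)) + v * (y $ i / real (pos i))" for i
    by (simp add: add_divide_distrib)
  show "u *\<^sub>R x + v *\<^sub>R y \<in> lecture_hall_region t"
    unfolding lecture_hall_region_def mem_Collect_eq eq
  proof (intro allI impI conjI)
    fix i j :: 'm assume "i \<le> j"
    note * = this x[unfolded lecture_hall_region_def] y[unfolded lecture_hall_region_def]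
    show "0 \<le> u * (x $ i / real (pos i)) + v * (y $ i / real (pos i))"
      using * uv by (intro add_nonneg_nonneg mult_nonneg_nonneg) auto
    show "u * (x $ i / real (pos i)) + v * (y $ i / real (pos i))
        \<le> u * (x $ j / real (pos j)) + v * (y $ j / real (pos j))"
      using * uv by (intro add_mono mult_left_mono) auto
    show "u * (x $ j / real (pos j)) + v * (y $ j / real (pos j)) \<le> t"
      using * uv by (intro convex_bound_le) auto
  qed
qed

lemma lecture_hall_vertex_in_region: "lecture_hall_vertex k \<in> lecture_hall_region 1"
proof -
  have "pos i > 0" for i :: 'a using pos_ge_1[of i] by linarith
  then show ?thesis
    by (auto simp: lecture_hall_region_def lecture_hall_vertex_def pos_le_iff[symmetric])
qed

lemma lecture_hall_vertex_in_int_points: "lecture_hall_vertex k \<in> int_points"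
  by (simp add: int_points_def lecture_hall_vertex_def)

text \<open>In a combination of the vertices, the ratio at position \<open>j\<close> is a partial sum of the
  coefficients. This triangular shape gives both the barycentric coordinates and the affine
  independence.\<close>

lemma sum_lecture_hall_vertices:
  fixes c :: "nat \<Rightarrow> real" and j :: "'m::{finite,linorder}"
  shows "(\<Sum>k = 1..Suc CARD('m). c k *\<^sub>R lecture_hall_vertex k) $ j = pos j * (\<Sum>k = 1..pos j. c k)"
proof -
  have "(\<Sum>k = 1..Suc CARD('m). c k *\<^sub>R lecture_hall_vertex k) $ j
      = (\<Sum>k = 1..Suc CARD('m). if k \<le> pos j then pos j * c k else 0)"
    by (auto simp: lecture_hall_vertex_def sum_component intro!: sum.cong)
  also have "\<dots> = (\<Sum>k \<in> {1..Suc CARD('m)} \<inter> {k. k \<le> pos j}. pos j * c k)"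
    by (subst sum.inter_restrict) auto
  also have "{1..Suc CARD('m)} \<inter> {k. k \<le> pos j} = {1..pos j}"
    using pos_le_card[of j] by auto
  finally show ?thesis by (simp add: sum_distrib_left)
qed

lemma inj_lecture_hall_vertex:
  "inj_on (lecture_hall_vertex :: nat \<Rightarrow> real ^ 'm::{finite,linorder}) {1..Suc CARD('m)}"
proof (rule linorder_inj_onI)
  fix a b assume ab: "a < b" "a \<in> {1..Suc CARD('m)}" "b \<in> {1..Suc CARD('m)}"
  then obtain j :: 'm where j: "pos j = a" using ex_pos[where 'm='m, of a] by auto
  then have "(lecture_hall_vertex a :: (real, 'm) vec) $ j \<noteq> lecture_hall_vertex b $ j"
    using ab by (simp add: lecture_hall_vertex_def)
  then show "(lecture_hall_vertex a :: (real, 'm) vec) \<noteq> lecture_hall_vertex b" by auto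
qed auto

text \<open>The barycentric coordinates of \<open>\<alpha>\<close> are the increments of the ratios \<open>\<alpha>\<^sub>j / j\<close>, which the
  inequalities make nonnegative.\<close>

lemma lecture_hall_region_subset_hull:
  "lecture_hall_region 1
    \<subseteq> convex hull (lecture_hall_vertex ` {1..Suc CARD('m)} :: (real ^ 'm::{finite,linorder}) set)"
proof
  fix \<alpha> :: "(real, 'm) vec" assume \<alpha>: "\<alpha> \<in> lecture_hall_region 1"
  \<comment> \<open>The ratios, continued by \<open>0\<close> on the left and \<open>1\<close> on the right so that the increments sum to 1.\<close>
  define r where "r k = (if k = 0 then 0 else if k \<le> CARD('m)
      then \<alpha> $ (inv pos k) / real k else 1)" for k
  have inv_pos: "inv pos (pos i) = i" for i :: 'm
    using bij_betw_pos[where 'm='m] by (simp add: bij_betw_def)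
  have r_pos: "r (pos i) = \<alpha> $ i / real (pos i)" for i :: 'm
    using pos_ge_1[of i] pos_le_card[of i] by (simp add: r_def inv_pos)
  have bounds: "0 \<le> r (pos i)" "r (pos i) \<le> 1" for i :: 'm
    using \<alpha> by (auto simp: r_pos lecture_hall_region_def)
  have nonneg: "r (k - 1) \<le> r k" if "k \<in> {1..Suc CARD('m)}" for k
  proof (cases "k = Suc CARD('m)")
    case True
    obtain i :: 'm where "pos i = CARD('m)" using ex_pos[where 'm='m, of "CARD('m)"] by (auto simp: Suc_le_eq)
    then show ?thesis using True bounds[of i] by (simp add: r_def)
  next
    case False
    then have "1 \<le> k" "k \<le> CARD('m)" using that by auto
    then obtain j :: 'm where j: "pos j = k" by (rule ex_pos)
    show ?thesis
    proof (cases "k = 1")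
      case True
      then show ?thesis using bounds[of j] j by (simp add: r_def)
    next
      case F: False
      then have "1 \<le> k - 1" "k - 1 \<le> CARD('m)" using that by auto
      then obtain i :: 'm where i: "pos i = k - 1" by (rule ex_pos)
      then have "i \<le> j" using j by (simp add: pos_le_iff[symmetric])
      then have "r (pos i) \<le> r (pos j)" using \<alpha> by (simp add: r_pos lecture_hall_region_def)
      then show ?thesis using i j by simp
    qed
  qed
  have tele: "(\<Sum>k = 1..j. r k - r (k - 1)) = r j" for j
    by (induction j) (simp_all add: r_def[of 0])
  have "\<alpha> = (\<Sum>k = 1..Suc CARD('m). (r k - r (k - 1)) *\<^sub>R lecture_hall_vertex k)"
  proof (subst vec_eq_iff, rule allI)
    fix j
    have "real (pos j) * r (pos j) = \<alpha> $ j"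
      using pos_ge_1[of j] by (simp add: r_pos)
    then show "\<alpha> $ j = (\<Sum>k = 1..Suc CARD('m). (r k - r (k - 1)) *\<^sub>R lecture_hall_vertex k) $ j"
      by (simp only: sum_lecture_hall_vertices tele)
  qed
  also have "\<dots> \<in> convex hull (lecture_hall_vertex ` {1..Suc CARD('m)})"
  proof (rule convex_sum)
    show "(\<Sum>k = 1..Suc CARD('m). r k - r (k - 1)) = 1"
      unfolding tele by (simp add: r_def)
    show "0 \<le> r k - r (k - 1)" if "k \<in> {1..Suc CARD('m)}" for k
      using nonneg[OF that] by simp
  qed (auto intro: hull_inc)
  finally show "\<alpha> \<in> convex hull (lecture_hall_vertex ` {1..Suc CARD('m)})" .
qed

text \<open>The hull of the integer points lies between the hull of the vertices and the region, and these
  two coincide.\<close>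

lemma lecture_hall_simplex_eq:
  "lecture_hall_simplex
    = convex hull (lecture_hall_vertex ` {1..Suc CARD('m)} :: (real ^ 'm::{finite,linorder}) set)"
  "lecture_hall_simplex = (lecture_hall_region 1 :: (real ^ 'm::{finite,linorder}) set)"
proof -
  let ?V = "lecture_hall_vertex ` {1..Suc CARD('m)} :: (real, 'm) vec set"
  have eq: "lecture_hall_simplex = convex hull (int_points \<inter> lecture_hall_region 1 :: (real, 'm) vec set)"
    unfolding lecture_hall_simplex_def lecture_hall_region_def
    by (rule arg_cong[of _ _ "\<lambda>S. convex hull S"]) auto
  have "convex hull ?V \<subseteq> lecture_hall_simplex"
    unfolding eq using lecture_hall_vertex_in_region lecture_hall_vertex_in_int_points
    by (intro hull_mono) auto
  moreover have "lecture_hall_simplex \<subseteq> (lecture_hall_region 1 :: (real, 'm) vec set)"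
    unfolding eq by (rule hull_minimal) (auto simp: convex_lecture_hall_region)
  ultimately show "lecture_hall_simplex = convex hull ?V"
    "lecture_hall_simplex = (lecture_hall_region 1 :: (real, 'm) vec set)"
    using lecture_hall_region_subset_hull[where 'm='m] by auto
qed

lemma affine_independent_lecture_hall_vertices:
  "\<not> affine_dependent (lecture_hall_vertex ` {1..Suc CARD('m)} :: (real ^ 'm::{finite,linorder}) set)"
proof
  let ?V = "lecture_hall_vertex ` {1..Suc CARD('m)} :: (real, 'm) vec set"
  assume "affine_dependent ?V"
  then obtain u where u: "sum u ?V = 0" "\<exists>v\<in>?V. u v \<noteq> 0" "(\<Sum>v\<in>?V. u v *\<^sub>R v) = 0"
    by (subst (asm) affine_dependent_explicit_finite) auto
  define c where "c k = u (lecture_hall_vertex k :: (real, 'm) vec)" for k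
  have s0: "(\<Sum>k = 1..Suc CARD('m). c k) = 0"
    using u(1) by (simp only: sum.reindex[OF inj_lecture_hall_vertex] o_def c_def)
  have v0: "(\<Sum>k = 1..Suc CARD('m). c k *\<^sub>R lecture_hall_vertex k :: (real, 'm) vec) = 0"
    using u(3) by (simp only: sum.reindex[OF inj_lecture_hall_vertex] o_def c_def)
  have zero: "(\<Sum>k = 1..j. c k) = 0" if "j \<le> Suc CARD('m)" for j
  proof (cases "j = 0 \<or> j = Suc CARD('m)")
    case True
    then show ?thesis using s0 by auto
  next
    case False
    then have "1 \<le> j" "j \<le> CARD('m)" using that by auto
    then obtain i :: 'm where i: "pos i = j" by (rule ex_pos)
    have "pos i * (\<Sum>k = 1..pos i. c k) = 0"
      using v0 by (simp only: sum_lecture_hall_vertices[symmetric] zero_index)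
    then show ?thesis using i False by simp
  qed
  have "c k = 0" if "k \<in> {1..Suc CARD('m)}" for k
  proof -
    define p where "p = k - 1"
    have p: "k = Suc p" using that by (simp add: p_def)
    have "c k = (\<Sum>i = 1..Suc p. c i) - (\<Sum>i = 1..p. c i)" unfolding p by simp
    also have "\<dots> = 0" using zero[of "Suc p"] zero[of p] that p by simp
    finally show ?thesis .
  qed
  then show False using u(2) by (auto simp: c_def)
qed

section \<open>The unimodular map between the two simplices\<close>

definition lecture_hall_map :: "real ^ 'n::{finite,linorder} \<Rightarrow> real ^ 'm::{finite,linorder}" where
  "lecture_hall_map x = (\<chi> j. - prefix_sum x (pos j))"

text \<open>The translation part is \<open>j + (1 + \<dots> + j)\<close> in coordinate \<open>j\<close>. It is kept apart from the linear
  part because a dilation by \<open>t\<close> scales only the translation.\<close>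

definition lecture_hall_shift :: "real ^ 'm::{finite,linorder}" where
  "lecture_hall_shift = (\<chi> j. real (pos j + \<Sum>{..pos j}))"

lemma linear_lecture_hall_map: "linear lecture_hall_map"
  by (rule linearI) (simp_all add: lecture_hall_map_def vec_eq_iff prefix_sum_add prefix_sum_scaleR)

lemma lecture_hall_map_one_at:
  assumes "CARD('n::{finite,linorder}) = n" "CARD('m::{finite,linorder}) \<le> n" "k \<in> {1..n}"
  shows "lecture_hall_map (perm_point (one_at n k) :: real ^ 'n::{finite,linorder}) + lecture_hall_shift
    = (lecture_hall_vertex k :: real ^ 'm::{finite,linorder})"
proof -
  have "pos j \<le> n" for j :: 'm using pos_le_card[of j] assms(2) by linarith
  then show ?thesis
    using assms(1,3)
    by (auto simp: vec_eq_iff lecture_hall_map_def lecture_hall_shift_def lecture_hall_vertex_def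
        prefix_sum_perm_point sum_one_at)
qed

lemma stack_sort_simplex_eq:
  assumes "1 \<le> n"
  shows "stack_sort_simplex n = convex hull (perm_point ` one_at n ` {1..n})"
  by (simp add: stack_sort_simplex_def sort_iterates_tau[OF assms])

lemma prefix_sum_stack_sort_simplex:
  assumes "1 \<le> n" "CARD('n::{finite,linorder}) = n" "(x :: real ^ 'n::{finite,linorder}) \<in> stack_sort_simplex n"
  shows "prefix_sum x n = real (\<Sum>{..n})"
proof -
  have "convex {x :: (real, 'n) vec. prefix_sum x n = real (\<Sum>{..n})}"
    by (rule convexI) (simp add: prefix_sum_add prefix_sum_scaleR distrib_right[symmetric])
  moreover have "perm_point ` one_at n ` {1..n} \<subseteq> {x :: (real, 'n) vec. prefix_sum x n = real (\<Sum>{..n})}"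
    using assms(2) by (auto simp: prefix_sum_perm_point sum_one_at)
  ultimately have "stack_sort_simplex n \<subseteq> {x :: (real, 'n) vec. prefix_sum x n = real (\<Sum>{..n})}"
    unfolding stack_sort_simplex_eq[OF assms(1)] by (rule hull_minimal[rotated])
  then show ?thesis using assms(3) by auto
qed

lemma lecture_hall_map_image_vertices:
  assumes "CARD('n::{finite,linorder}) = n" "CARD('m::{finite,linorder}) = n - 1" "1 \<le> n"
  shows "(\<lambda>x. lecture_hall_map x + lecture_hall_shift) `
      (perm_point ` one_at n ` {1..n} :: (real ^ 'n::{finite,linorder}) set)
    = (lecture_hall_vertex ` {1..Suc CARD('m)} :: (real ^ 'm::{finite,linorder}) set)"
  unfolding image_image using assms by (intro image_cong) (auto simp: lecture_hall_map_one_at)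

lemma lecture_hall_map_image_simplex:
  assumes "CARD('n::{finite,linorder}) = n" "CARD('m::{finite,linorder}) = n - 1" "1 \<le> n"
  shows "(\<lambda>x. lecture_hall_map x + lecture_hall_shift) `
      (stack_sort_simplex n :: (real ^ 'n::{finite,linorder}) set)
    = (lecture_hall_simplex :: (real ^ 'm::{finite,linorder}) set)"
proof -
  have comp: "(\<lambda>x. lecture_hall_map x + lecture_hall_shift) ` S
      = (\<lambda>x. lecture_hall_shift + x) ` (lecture_hall_map :: (real, 'n) vec \<Rightarrow> (real, 'm) vec) ` S" for S
    by (auto simp: image_image add.commute)
  show ?thesis
    unfolding stack_sort_simplex_eq[OF assms(3)] lecture_hall_simplex_eq(1)
      lecture_hall_map_image_vertices[OF assms, symmetric] comp
    by (simp add: convex_hull_translation convex_hull_linear_image[OF linear_lecture_hall_map])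
qed

text \<open>Affine independence is pulled back along the affine map: a linear map cannot raise the
  dimension, and the image already has the largest dimension possible for \<open>n\<close> points.\<close>

lemma affine_independent_orbit:
  assumes "CARD('n::{finite,linorder}) = n" "1 \<le> n" "CARD('m::{finite,linorder}) = n - 1"
  defines "C \<equiv> perm_point ` one_at n ` {1..n} :: (real ^ 'n::{finite,linorder}) set"
  shows "\<not> affine_dependent C" "card C = n"
proof -
  let ?W = "lecture_hall_vertex ` {1..Suc CARD('m)} :: (real, 'm) vec set"
  have fin: "finite C" by (simp add: C_def)
  have img: "(\<lambda>x. lecture_hall_shift + x) ` lecture_hall_map ` C = ?W"
    using lecture_hall_map_image_vertices[OF assms(1,3,2)]
    by (simp add: C_def image_image add.commute)
  have cardW: "card ?W = n"
    using card_image[OF inj_lecture_hall_vertex[where 'm='m]] assms by simp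
  have "card ?W \<le> card C"
    unfolding img[symmetric] using fin by (meson card_image_le finite_imageI order_trans)
  moreover have "card C \<le> n"
    unfolding C_def image_image using card_image_le[of "{1..n}"] by simp
  ultimately show card: "card C = n" using cardW by simp
  have "int n - 1 = aff_dim ?W"
    using affine_independent_iff_card[of ?W] affine_independent_lecture_hall_vertices[where 'm='m] cardW
    by simp
  also have "\<dots> = aff_dim (lecture_hall_map ` C :: (real, 'm) vec set)"
    unfolding img[symmetric] by (rule aff_dim_translation_eq)
  also have "\<dots> \<le> aff_dim C" by (rule aff_dim_linear_image_le[OF linear_lecture_hall_map])
  finally have "aff_dim C = int (card C) - 1"
    using aff_dim_le_card[OF fin] card by simp
  then show "\<not> affine_dependent C" using fin by (simp add: affine_independent_iff_card)
qed

text \<open>A point of the dilated stack-sort simplex has prefix sums \<open>0\<close> at \<open>0\<close> and \<open>t (1 + \<dots> + n)\<close> at \<open>n\<close>;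
  the remaining ones are, up to sign and an integral translation, the coordinates of its image. So
  the image determines the point, and an integral image forces an integral point.\<close>

lemma bij_betw_dilated_simplices:
  assumes "CARD('n::{finite,linorder}) = n" "CARD('m::{finite,linorder}) = n - 1" "1 \<le> n"
  shows "bij_betw (\<lambda>x. lecture_hall_map x + real t *\<^sub>R lecture_hall_shift)
    ((\<lambda>x. real t *\<^sub>R x) ` stack_sort_simplex n \<inter> int_points :: (real ^ 'n::{finite,linorder}) set)
    ((\<lambda>x. real t *\<^sub>R x) ` lecture_hall_simplex \<inter> int_points :: (real ^ 'm::{finite,linorder}) set)"
    (is "bij_betw ?F ?D ?P")
proof -
  have scale: "?F (real t *\<^sub>R y) = real t *\<^sub>R (lecture_hall_map y + lecture_hall_shift)" for y
    by (simp add: linear_cmul[OF linear_lecture_hall_map] scaleR_add_right)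
  have shift_int: "(real t *\<^sub>R lecture_hall_shift :: (real, 'm) vec) $ j \<in> \<int>" for j
    by (simp add: lecture_hall_shift_def del: of_nat_add of_nat_sum)
  have total: "prefix_sum x n = real t * real (\<Sum>{..n})"
    if "x \<in> (\<lambda>x. real t *\<^sub>R x) ` stack_sort_simplex n" for x :: "(real, 'n) vec"
    using that prefix_sum_stack_sort_simplex[OF assms(3,1)] by (auto simp: prefix_sum_scaleR)
  have prefix: "prefix_sum x (pos j) = (real t *\<^sub>R lecture_hall_shift :: (real, 'm) vec) $ j - ?F x $ j"
    for x j by (simp add: lecture_hall_map_def)
  have prefix_cases: "k = 0 \<or> k = n \<or> (\<exists>j::'m. pos j = k)" if "k \<le> n" for k
  proof (cases "k = 0 \<or> k = n")
    case False
    then have "1 \<le> k" "k \<le> CARD('m)" using that assms(2) by auto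
    then obtain j :: 'm where "pos j = k" by (rule ex_pos)
    then show ?thesis by blast
  qed blast
  have prefix_0: "prefix_sum x 0 = 0" for x :: "(real, 'n) vec"
  proof -
    have "pos i \<noteq> 0" for i :: 'n using pos_ge_1[of i] by linarith
    then have "{i::'n. pos i \<le> 0} = {}" by simp
    then show ?thesis by (simp only: prefix_sum_def sum.empty)
  qed
  have inj: "inj_on ?F ?D"
  proof (rule inj_onI)
    fix x y assume xy: "x \<in> ?D" "y \<in> ?D" "?F x = ?F y"
    have eq: "prefix_sum x k = prefix_sum y k" if "k \<le> n" for k
      using prefix_cases[OF that] total[of x] total[of y] xy prefix[of x] prefix[of y]
      by (auto simp: prefix_0)
    show "x = y"
    proof (subst vec_eq_iff, rule allI)
      fix i :: 'n
      have "pos i \<le> n" "pos i - 1 \<le> n" using pos_le_card[of i] assms(1) by auto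
      then show "x $ i = y $ i" by (simp only: nth_eq_prefix_sum_diff eq)
    qed
  qed
  have into: "?F ` ?D \<subseteq> ?P"
  proof safe
    fix y :: "(real, 'n) vec" assume y: "y \<in> stack_sort_simplex n" and int: "real t *\<^sub>R y \<in> int_points"
    show "?F (real t *\<^sub>R y) \<in> (\<lambda>x. real t *\<^sub>R x) ` lecture_hall_simplex"
      unfolding scale lecture_hall_map_image_simplex[OF assms, symmetric] using y by blast
    have "prefix_sum (real t *\<^sub>R y) k \<in> \<int>" for k
      using int unfolding prefix_sum_def int_points_def by (intro Ints_sum) auto
    then show "?F (real t *\<^sub>R y) \<in> int_points"
      using shift_int by (simp add: int_points_def lecture_hall_map_def)
  qed
  have onto: "?P \<subseteq> ?F ` ?D"
  proof
    fix \<beta> assume \<beta>: "\<beta> \<in> ?P"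
    then obtain y where y: "y \<in> stack_sort_simplex n" "\<beta> = ?F (real t *\<^sub>R y)"
      unfolding lecture_hall_map_image_simplex[OF assms, symmetric] scale by blast
    let ?x = "real t *\<^sub>R y"
    have "prefix_sum ?x k \<in> \<int>" if "k \<le> n" for k
      using prefix_cases[OF that]
    proof (elim disjE exE)
      assume "k = n"
      then show ?thesis using total[OF imageI[OF y(1)]] by (simp del: of_nat_sum)
    next
      fix j :: 'm assume j: "pos j = k"
      have "prefix_sum ?x (pos j) \<in> \<int>"
        unfolding prefix y(2)[symmetric] using shift_int \<beta> by (auto simp: int_points_def)
      then show ?thesis using j by simp
    qed (simp add: prefix_0)
    then have "?x $ i \<in> \<int>" for i
      unfolding nth_eq_prefix_sum_diff[of ?x] using pos_le_card[of i] assms(1) by auto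
    then have "?x \<in> ?D" using y(1) unfolding int_points_def by blast
    then show "\<beta> \<in> ?F ` ?D" using y(2) by blast
  qed
  show ?thesis unfolding bij_betw_def using inj subset_antisym[OF into onto] ..
qed

section \<open>Counting lecture-hall sequences\<close>

text \<open>Sequences with \<open>f 1 / 1 \<le> f 2 / 2 \<le> \<dots> \<le> f m / m\<close>, in integer arithmetic, stored as functions
  that vanish outside \<open>1, \<dots>, m\<close>. For \<open>m > 0\<close> the inequality at \<open>k = 0\<close> forces \<open>f 0 = 0\<close>; for \<open>m = 0\<close>
  it is absent, and only the bound \<open>N = 0\<close> gives the empty sequence alone.\<close>

definition lecture_hall_seqs :: "nat \<Rightarrow> nat \<Rightarrow> (nat \<Rightarrow> nat) set" where
  "lecture_hall_seqs m N =
    {f. (\<forall>k<m. Suc k * f k \<le> k * f (Suc k)) \<and> f m \<le> N \<and> (\<forall>k>m. f k = 0)}"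

text \<open>Fixing the last entry \<open>a\<close> leaves a sequence of length \<open>m\<close> whose last entry is at most
  \<open>m a / (m + 1)\<close>.\<close>

lemma lecture_hall_seqs_last:
  "{f \<in> lecture_hall_seqs (Suc m) N. f (Suc m) = a} =
    (if a \<le> N then (\<lambda>f. f(Suc m := a)) ` lecture_hall_seqs m (m * a div Suc m) else {})"
proof -
  have iff: "b \<le> m * a div Suc m \<longleftrightarrow> Suc m * b \<le> m * a" for b
    by (simp add: less_eq_div_iff_mult_less_eq mult.commute del: mult_Suc mult_Suc_right)
  have "f \<in> (\<lambda>f. f(Suc m := a)) ` lecture_hall_seqs m (m * a div Suc m)"
    if f: "f \<in> lecture_hall_seqs (Suc m) N" "f (Suc m) = a" for f
  proof (rule image_eqI)
    show "f = (f(Suc m := 0))(Suc m := a)" using f by auto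
    show "f(Suc m := 0) \<in> lecture_hall_seqs m (m * a div Suc m)"
      using f by (auto simp: lecture_hall_seqs_def iff simp del: mult_Suc mult_Suc_right)
  qed
  moreover have "f(Suc m := a) \<in> lecture_hall_seqs (Suc m) N"
    if "f \<in> lecture_hall_seqs m (m * a div Suc m)" "a \<le> N" for f
    using that by (auto simp: lecture_hall_seqs_def iff less_Suc_eq simp del: mult_Suc mult_Suc_right)
  ultimately show ?thesis by (auto simp: lecture_hall_seqs_def[of "Suc m" N])
qed

lemma card_lecture_hall_seqs_last:
  assumes "finite (lecture_hall_seqs m (m * a div Suc m))" "a \<le> N"
  shows "finite {f \<in> lecture_hall_seqs (Suc m) N. f (Suc m) = a}"
    "card {f \<in> lecture_hall_seqs (Suc m) N. f (Suc m) = a}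
      = card (lecture_hall_seqs m (m * a div Suc m))"
proof -
  have "inj_on (\<lambda>f. f(Suc m := a)) (lecture_hall_seqs m (m * a div Suc m))"
  proof (rule inj_onI)
    fix f g assume fg: "f \<in> lecture_hall_seqs m (m * a div Suc m)"
      "g \<in> lecture_hall_seqs m (m * a div Suc m)" "f(Suc m := a) = g(Suc m := a)"
    then have "f (Suc m) = g (Suc m)" by (simp add: lecture_hall_seqs_def)
    then show "f = g" using fg(3) by (metis fun_upd_triv fun_upd_upd)
  qed
  then show "card {f \<in> lecture_hall_seqs (Suc m) N. f (Suc m) = a}
      = card (lecture_hall_seqs m (m * a div Suc m))"
    using assms(2) by (simp add: lecture_hall_seqs_last card_image)
  show "finite {f \<in> lecture_hall_seqs (Suc m) N. f (Suc m) = a}"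
    using assms by (simp add: lecture_hall_seqs_last)
qed

text \<open>Raising the bound from \<open>N = (m + 1) t + r\<close> to \<open>N + 1\<close> adds the sequences ending in \<open>N + 1\<close>. Since
  \<open>m (N + 1) div (m + 1) = m t + r\<close>, there are \<open>(t + 1)\<^bsup>m - r\<^esup> (t + 2)\<^bsup>r\<^esup>\<close> of them by induction on the
  length, and this is what turns one factor \<open>t + 1\<close> of the count into \<open>t + 2\<close>. At \<open>r = m + 1\<close> all
  factors are turned, which is the case \<open>r = 0\<close> for \<open>t + 1\<close>.\<close>

lemma card_lecture_hall_seqs:
  assumes "r \<le> m"
  shows "finite (lecture_hall_seqs m (m * t + r)) \<and>
    card (lecture_hall_seqs m (m * t + r)) = (t + 1) ^ (m - r) * (t + 2) ^ r"
  using assms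
proof (induction m arbitrary: t r)
  case 0
  have "lecture_hall_seqs 0 0 = {\<lambda>_. 0}"
    by (auto simp: lecture_hall_seqs_def fun_eq_iff) (metis gr0I)
  then show ?case using 0 by simp
next
  case (Suc m)
  note IH = Suc.IH
  let ?L = "lecture_hall_seqs (Suc m)"
  define good where "good t r \<longleftrightarrow> finite (?L (Suc m * t + r)) \<and>
    card (?L (Suc m * t + r)) = (t + 1) ^ (Suc m - r) * (t + 2) ^ r" for t r
  have good_0_0: "good 0 0"
  proof -
    have "?L 0 = {f \<in> ?L 0. f (Suc m) = 0}" by (auto simp: lecture_hall_seqs_def)
    then show ?thesis
      using IH[of 0 0] card_lecture_hall_seqs_last[of m 0 0] by (simp add: good_def)
  qed
  have good_Suc: "good t (Suc r)" if "good t r" "r \<le> m" for t r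
  proof -
    let ?N = "Suc m * t + r"
    \<comment> \<open>The remainder \<open>m - r\<close> is less than \<open>m + 1\<close>.\<close>
    have "m * Suc ?N = (m - r) + Suc m * (m * t + r)"
      using that(2) by (simp add: algebra_simps)
    also have "\<dots> div Suc m = m * t + r"
      using that(2) by (subst div_mult_self2) (simp_all del: mult_Suc)
    finally have div: "m * Suc ?N div Suc m = m * t + r" .
    let ?S = "{f \<in> ?L (Suc ?N). f (Suc m) = Suc ?N}"
    have S: "finite ?S" "card ?S = (t + 1) ^ (m - r) * (t + 2) ^ r"
      using card_lecture_hall_seqs_last[of m "Suc ?N" "Suc ?N"] IH[OF that(2), of t]
      unfolding div by simp_all
    have split: "?L (Suc ?N) = ?L ?N \<union> ?S" and disj: "?L ?N \<inter> ?S = {}"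
      by (auto simp: lecture_hall_seqs_def le_Suc_eq simp del: mult_Suc)
    have "card (?L (Suc ?N)) = card (?L ?N) + card ?S"
      using S(1) that(1) disj by (subst split, intro card_Un_disjoint) (simp_all add: good_def)
    then have "card (?L (Suc ?N)) = (t + 1) ^ (Suc m - r) * (t + 2) ^ r + (t + 1) ^ (m - r) * (t + 2) ^ r"
      using S(2) that(1) unfolding good_def by (simp only:)
    also have "\<dots> = (t + 1) ^ (m - r) * (t + 2) ^ Suc r"
      using that(2) by (simp add: Suc_diff_le algebra_simps)
    finally have "card (?L (Suc ?N)) = (t + 1) ^ (m - r) * (t + 2) ^ Suc r" .
    moreover have "finite (?L (Suc ?N))"
      using S(1) that(1) by (subst split) (simp add: good_def)
    ultimately show ?thesis
      unfolding good_def by (simp only: add_Suc_right diff_Suc_Suc simp_thms)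
  qed
  have row: "good t r" if "good t 0" "r \<le> Suc m" for t r
    using that(2) by (induction r) (auto intro: that(1) good_Suc)
  have "good t 0" for t
  proof (induction t)
    case 0
    show ?case by (rule good_0_0)
  next
    case (Suc t)
    then show ?case using row[of t "Suc m"] by (simp add: good_def algebra_simps)
  qed
  from row[OF this Suc.prems] show ?case unfolding good_def .
qed

text \<open>For \<open>t = 0\<close> both sides reduce to the origin; for \<open>t > 0\<close> the inequalities are homogeneous.\<close>

lemma dilated_lecture_hall_simplex:
  "(\<lambda>x. real t *\<^sub>R x) ` lecture_hall_simplex
    = (lecture_hall_region (real t) :: (real ^ 'm::{finite,linorder}) set)"
proof (cases "t = 0")
  case True
  have "\<beta> $ i = 0" if "\<beta> \<in> lecture_hall_region 0" for \<beta> :: "(real, 'm) vec" and i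
  proof -
    have "0 \<le> \<beta> $ i / real (pos i)" "\<beta> $ i / real (pos i) \<le> 0"
      using that unfolding lecture_hall_region_def by blast+
    then have "\<beta> $ i / real (pos i) = 0" by (rule order_antisym[rotated])
    then show ?thesis using pos_ge_1[of i] by simp
  qed
  then have "\<beta> = 0" if "\<beta> \<in> lecture_hall_region 0" for \<beta> :: "(real, 'm) vec"
    using that by (simp add: vec_eq_iff)
  moreover have "0 \<in> (lecture_hall_region 0 :: (real, 'm) vec set)"
    by (simp add: lecture_hall_region_def)
  ultimately have "lecture_hall_region 0 = {0 :: (real, 'm) vec}" by blast
  moreover have "lecture_hall_simplex \<noteq> ({} :: (real, 'm) vec set)"
    unfolding lecture_hall_simplex_eq(2) using lecture_hall_vertex_in_region by blast
  ultimately show ?thesis using True by auto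
next
  case False
  then have t: "real t > 0" by simp
  have iff: "real t *\<^sub>R \<alpha> \<in> lecture_hall_region (real t) \<longleftrightarrow> \<alpha> \<in> lecture_hall_region 1"
    for \<alpha> :: "(real, 'm) vec"
  proof -
    have "(real t *\<^sub>R \<alpha>) $ i / real (pos i) = real t * (\<alpha> $ i / real (pos i))" for i by simp
    moreover have "real t * a \<le> real t \<longleftrightarrow> a \<le> 1" for a
      using t mult_le_cancel_left_pos[of "real t" a 1] by simp
    ultimately show ?thesis
      unfolding lecture_hall_region_def mem_Collect_eq
      using t by (simp only: mult_le_cancel_left_pos zero_le_mult_iff) auto
  qed
  show ?thesis
    unfolding lecture_hall_simplex_eq(2)
  proof (intro subset_antisym subsetI)
    fix \<beta> :: "(real, 'm) vec" assume \<beta>: "\<beta> \<in> lecture_hall_region (real t)"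
    have eq: "\<beta> = real t *\<^sub>R ((1 / real t) *\<^sub>R \<beta>)" using t by simp
    then have "(1 / real t) *\<^sub>R \<beta> \<in> lecture_hall_region 1" using \<beta> iff by metis
    with eq show "\<beta> \<in> (\<lambda>x. real t *\<^sub>R x) ` lecture_hall_region 1" by (rule image_eqI)
  qed (auto simp: iff)
qed

lemma bij_betw_lecture_hall_seqs:
  "bij_betw (\<lambda>f. \<chi> j. real (f (pos j))) (lecture_hall_seqs CARD('m) (CARD('m) * t))
    (lecture_hall_region (real t) \<inter> int_points :: (real ^ 'm::{finite,linorder}) set)"
  (is "bij_betw ?F ?S ?P")
proof -
  have inj: "inj_on ?F ?S"
  proof (rule inj_onI, rule ext)
    fix f g k assume fg: "f \<in> ?S" "g \<in> ?S" "?F f = ?F g"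
    have vanish: "h 0 = 0" if "h \<in> ?S" for h
    proof -
      have "Suc 0 * h 0 \<le> 0 * h (Suc 0)"
        using that zero_less_card_finite[where 'a='m] unfolding lecture_hall_seqs_def by blast
      then show ?thesis by simp
    qed
    consider "k = 0" | "k > CARD('m)" | j :: 'm where "pos j = k"
      using ex_pos[where 'm='m, of k] by (metis One_nat_def Suc_leI linorder_not_less neq0_conv)
    then show "f k = g k"
    proof cases
      case 1
      then show ?thesis using vanish[OF fg(1)] vanish[OF fg(2)] by simp
    next
      case 2
      then show ?thesis using fg by (simp add: lecture_hall_seqs_def)
    next
      case 3
      then show ?thesis using fg(3) by (auto simp: vec_eq_iff)
    qed
  qed
  have into: "?F f \<in> ?P" if f: "f \<in> ?S" for f
  proof -
    have ratio_mono_Suc: "real (f k) / real k \<le> real (f (Suc k)) / real (Suc k)"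
      if "1 \<le> k" "k < CARD('m)" for k
    proof -
      have "real (Suc k * f k) \<le> real (k * f (Suc k))"
        using f that by (intro of_nat_mono) (simp add: lecture_hall_seqs_def)
      then show ?thesis using that by (simp add: field_simps)
    qed
    have ratio_mono: "real (f k) / real k \<le> real (f l) / real l"
      if "k \<le> l" "1 \<le> k" "l \<le> CARD('m)" for k l
      using that
    proof (induction l rule: dec_induct)
      case base
      show ?case ..
    next
      case (step l)
      have "real (f k) / real k \<le> real (f l) / real l" using step by simp
      also have "\<dots> \<le> real (f (Suc l)) / real (Suc l)" using ratio_mono_Suc[of l] step by simp
      finally show ?case .
    qed
    have "real (f CARD('m)) \<le> real (CARD('m) * t)"
      using f by (intro of_nat_mono) (simp add: lecture_hall_seqs_def)
    then have top: "real (f CARD('m)) / real CARD('m) \<le> real t"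
      by (simp add: field_simps)
    have "real (f (pos j)) / real (pos j) \<le> real t" for j :: 'm
      using ratio_mono[of "pos j" "CARD('m)"] top pos_ge_1[of j] pos_le_card[of j] by linarith
    moreover have "real (f (pos i)) / real (pos i) \<le> real (f (pos j)) / real (pos j)"
      if "pos i \<le> pos j" for i j :: 'm
      using ratio_mono[OF that pos_ge_1 pos_le_card] .
    ultimately show ?thesis
      by (auto simp: lecture_hall_region_def int_points_def pos_le_iff[symmetric])
  qed
  have onto: "\<beta> \<in> ?F ` ?S" if \<beta>: "\<beta> \<in> ?P" for \<beta>
  proof -
    define f where "f k = (if 1 \<le> k \<and> k \<le> CARD('m) then nat \<lfloor>\<beta> $ inv pos k\<rfloor> else 0)" for k
    have inv_pos: "inv pos (pos i) = i" for i :: 'm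
      using bij_betw_pos[where 'm='m] by (simp add: bij_betw_def)
    have f_pos: "real (f (pos j)) = \<beta> $ j" for j
    proof -
      have "0 \<le> \<beta> $ j / real (pos j)" using \<beta> by (auto simp: lecture_hall_region_def)
      then have "0 \<le> \<beta> $ j" using pos_ge_1[of j] by (simp add: zero_le_divide_iff)
      moreover have "\<beta> $ j \<in> \<int>" using \<beta> by (simp add: int_points_def)
      ultimately show ?thesis
        using pos_ge_1[of j] pos_le_card[of j] by (auto simp: f_def inv_pos elim!: Ints_cases)
    qed
    have "f \<in> ?S"
      unfolding lecture_hall_seqs_def mem_Collect_eq
    proof (intro conjI allI impI)
      fix k assume k: "k < CARD('m)"
      show "Suc k * f k \<le> k * f (Suc k)"
      proof (cases "k = 0")
        case True
        then show ?thesis by (simp add: f_def)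
      next
        case False
        obtain i :: 'm where i: "pos i = k" using ex_pos[where 'm='m, of k] False k by auto
        obtain j :: 'm where j: "pos j = Suc k" using ex_pos[where 'm='m, of "Suc k"] k by auto
        have "i \<le> j" using i j by (simp add: pos_le_iff[symmetric])
        then have "\<beta> $ i / real (pos i) \<le> \<beta> $ j / real (pos j)"
          using \<beta> by (auto simp: lecture_hall_region_def)
        then have "real (f k) / real k \<le> real (f (Suc k)) / real (Suc k)"
          unfolding f_pos[symmetric] i j .
        then have "real (Suc k * f k) \<le> real (k * f (Suc k))"
          using False by (simp add: field_simps)
        then show ?thesis by (simp only: of_nat_le_iff)
      qed
    next
      obtain j :: 'm where j: "pos j = CARD('m)" using ex_pos[where 'm='m, of "CARD('m)"] by (auto simp: Suc_le_eq)
      have "\<beta> $ j / real (pos j) \<le> real t" using \<beta> by (auto simp: lecture_hall_region_def)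
      then have "real (f CARD('m)) \<le> real (CARD('m) * t)"
        unfolding f_pos[symmetric] j by (simp add: field_simps)
      then show "f CARD('m) \<le> CARD('m) * t" by (simp only: of_nat_le_iff)
    qed (simp add: f_def)
    moreover have "\<beta> = ?F f" by (simp add: vec_eq_iff f_pos)
    ultimately show ?thesis by blast
  qed
  show ?thesis unfolding bij_betw_def using inj into onto by blast
qed

lemma lattice_count_lecture_hall_simplex:
  "lattice_count (lecture_hall_simplex :: (real ^ 'm::{finite,linorder}) set) t = (t + 1) ^ CARD('m)"
  using bij_betw_same_card[OF bij_betw_lecture_hall_seqs[where 'm='m, of t]]
    card_lecture_hall_seqs[of 0 "CARD('m)" t]
  by (simp add: lattice_count_def dilated_lecture_hall_simplex)

theorem theorem5p2:
  fixes n :: nat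
    and D :: "(real ^ 'n::{finite,linorder}) set"
    and P :: "(real ^ 'm::{finite,linorder}) set"
  assumes "n \<ge> 2"
    and "CARD('n) = n"
    and "CARD('m) = n - 1"
  defines "D \<equiv> stack_sort_simplex n"
    and "P \<equiv> lecture_hall_simplex"
  shows "(int n - 1) simplex D \<and> (int n - 1) simplex P \<and>
    integrally_equivalent D P \<and>
    (\<forall>t::nat. lattice_count D t = lattice_count P t \<and> lattice_count P t = (t + 1) ^ (n - 1))"
proof -
  let ?V = "perm_point ` one_at n ` {1..n} :: (real, 'n) vec set"
  let ?W = "lecture_hall_vertex ` {1..Suc CARD('m)} :: (real, 'm) vec set"
  have n: "1 \<le> n" using assms(1) by simp
  have D: "D = convex hull ?V" unfolding D_def by (rule stack_sort_simplex_eq[OF n])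
  have P: "P = convex hull ?W" unfolding P_def by (rule lecture_hall_simplex_eq(1))
  note bij = bij_betw_dilated_simplices[OF assms(2,3) n, folded D_def P_def]
  have "(int n - 1) simplex D"
    unfolding simplex_def using affine_independent_orbit[OF assms(2) n assms(3)] D
    by (intro exI[of _ ?V]) auto
  moreover have "(int n - 1) simplex P"
    unfolding simplex_def
    using affine_independent_lecture_hall_vertices[where 'm='m] P assms
      card_image[OF inj_lecture_hall_vertex[where 'm='m]]
    by (intro exI[of _ ?W]) auto
  moreover have "integrally_equivalent D P"
    unfolding integrally_equivalent_def
  proof (intro conjI)
    have "?V \<subseteq> int_points" by (auto simp: int_points_def perm_point_def)
    moreover have "finite ?V" by simp
    ultimately show "lattice_polytope D"
      unfolding lattice_polytope_def using D by (intro exI[of _ ?V] conjI)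
    have "?W \<subseteq> int_points" using lecture_hall_vertex_in_int_points by auto
    moreover have "finite ?W" by simp
    ultimately show "lattice_polytope P"
      unfolding lattice_polytope_def using P by (intro exI[of _ ?W] conjI)
    have "bij_betw (\<lambda>x. lecture_hall_map x + lecture_hall_shift) (D \<inter> int_points) (P \<inter> int_points)"
      using bij[of 1] by simp
    with linear_lecture_hall_map
    show "\<exists>f c. linear f \<and> bij_betw (\<lambda>x. f x + c) (D \<inter> int_points) (P \<inter> int_points)"
      by (intro exI conjI)
  qed
  moreover have "lattice_count D t = lattice_count P t" for t
    unfolding lattice_count_def using bij[of t] by (rule bij_betw_same_card)
  moreover have "lattice_count P t = (t + 1) ^ (n - 1)" for t
    unfolding P_def lattice_count_lecture_hall_simplex assms(3) ..
  ultimately show ?thesis by blast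
qed

end
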